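(* Let $\varphi\in\mathcal{D}(X)$. Then $$(\partial_S+q)\,\mathcal{B}^S_{\mathbb{H}}(\varphi)(q)=\sqrt2\,\mathcal{B}^S_{\mathbb{H}}(x\varphi)(q),\qquad\forall q\in\mathbb{H}.$$
   Context: $\mathbb{H}$ is the algebra of real quaternions, $\mathbb{S}=\{q\in\mathbb{H}:q^2=-1\}$, and $\mathbb{C}_I=\mathbb{R}+\mathbb{R}I$ for $I\in\mathbb{S}$. $L^2(\mathbb{R},\mathbb{H})$ is the space of square integrable $\mathbb{H}$-valued functions on $\mathbb{R}$. The position operator is $X\varphi(x)=x\varphi(x)$ with domain $\mathcal{D}(X)=\{\varphi\in L^2(\mathbb{R},\mathbb{H}): X\varphi\in L^2(\mathbb{R},\mathbb{H})\}$; $x\varphi$ denotes the function $X\varphi$. The quaternionic Segal-Bargmann transform (with parameter $\nu=1$) is $$\mathcal{B}^S_{\mathbb{H}}(\varphi)(q)=\int_{\mathbb{R}}\mathcal{A}^S_{\mathbb{H}}(q,x)\varphi(x)\,dx,\qquad \mathcal{A}^S_{\mathbb{H}}(q,x)=\pi^{-3/4}e^{-\frac12(q^2+x^2)+\sqrt2\,qx},\quad q\in\mathbb{H},\ x\in\mathbb{R};$$ its values are (left) slice regular functions on $\mathbb{H}$, i.e. functions $f$ whose restriction $f_I$ to each $\mathbb{C}_I$ ($I\in\mathbb{S}$) has continuous partial derivatives and satisfies $\frac12\left(\frac{\partial}{\partial x}+I\frac{\partial}{\partial y}\right)f_I(x+Iy)=0$. The slice derivative $\partial_Sf$ of a slice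 regular $f$ is the function on $\mathbb{H}$ given on each $\mathbb{C}_I$ by $\partial_Sf(x+Iy)=\frac12\left(\frac{\partial}{\partial x}-I\frac{\partial}{\partial y}\right)f_I(x+Iy)$. The operator $\partial_S+q$ acts by $f\mapsto\partial_Sf(q)+q f(q)$ (left multiplication by $q$). *)

theory Defs
  imports "HOL-Analysis.Analysis"
begin

section \<open>The quaternions\<close>

datatype quat = Quat (qre: real) (qi: real) (qj: real) (qk: real)

lemma quat_eq_iff: "p = q \<longleftrightarrow> qre p = qre q \<and> qi p = qi q \<and> qj p = qj q \<and> qk p = qk q"
  by (cases p; cases q) simp

instantiation quat :: ring_1
begin

definition "0 = Quat 0 0 0 0"
definition "1 = Quat 1 0 0 0"
definition "p + q = Quat (qre p + qre q) (qi p + qi q) (qj p + qj q) (qk p + qk q)"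
definition "- p = Quat (- qre p) (- qi p) (- qj p) (- qk p)"
definition "p - q = Quat (qre p - qre q) (qi p - qi q) (qj p - qj q) (qk p - qk q)"
definition "p * q = Quat
  (qre p * qre q - qi p * qi q - qj p * qj q - qk p * qk q)
  (qre p * qi q + qi p * qre q + qj p * qk q - qk p * qj q)
  (qre p * qj q - qi p * qk q + qj p * qre q + qk p * qi q)
  (qre p * qk q + qi p * qj q - qj p * qi q + qk p * qre q)"

instance
  by standard
    (simp_all add: zero_quat_def one_quat_def plus_quat_def uminus_quat_def minus_quat_def
      times_quat_def quat_eq_iff algebra_simps)

end

lemma quat_sel_simps [simp]:
  "qre 0 = 0" "qi 0 = 0" "qj 0 = 0" "qk 0 = 0"
  "qre 1 = 1" "qi 1 = 0" "qj 1 = 0" "qk 1 = 0"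
  "qre (p + q) = qre p + qre q" "qi (p + q) = qi p + qi q"
  "qj (p + q) = qj p + qj q" "qk (p + q) = qk p + qk q"
  "qre (- p) = - qre p" "qi (- p) = - qi p" "qj (- p) = - qj p" "qk (- p) = - qk p"
  "qre (p - q) = qre p - qre q" "qi (p - q) = qi p - qi q"
  "qj (p - q) = qj p - qj q" "qk (p - q) = qk p - qk q"
  by (simp_all add: zero_quat_def one_quat_def plus_quat_def uminus_quat_def minus_quat_def)

lemma quat_sel_times:
  "qre (p * q) = qre p * qre q - qi p * qi q - qj p * qj q - qk p * qk q"
  "qi (p * q) = qre p * qi q + qi p * qre q + qj p * qk q - qk p * qj q"
  "qj (p * q) = qre p * qj q - qi p * qk q + qj p * qre q + qk p * qi q"
  "qk (p * q) = qre p * qk q + qi p * qj q - qj p * qi q + qk p * qre q"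
  by (simp_all add: times_quat_def)

instantiation quat :: real_algebra_1
begin

definition "r *\<^sub>R q = Quat (r * qre q) (r * qi q) (r * qj q) (r * qk q)"

instance
  by standard (simp_all add: scaleR_quat_def quat_eq_iff quat_sel_times algebra_simps)

end

lemma quat_sel_scaleR [simp]:
  "qre (r *\<^sub>R q) = r * qre q" "qi (r *\<^sub>R q) = r * qi q"
  "qj (r *\<^sub>R q) = r * qj q" "qk (r *\<^sub>R q) = r * qk q"
  by (simp_all add: scaleR_quat_def)

lemma quat_sel_of_real [simp]:
  "qre (of_real r) = r" "qi (of_real r) = 0" "qj (of_real r) = 0" "qk (of_real r) = 0"
  by (simp_all add: of_real_def)

instantiation quat :: real_inner
begin

definition "inner p q = qre p * qre q + qi p * qi q + qj p * qj q + qk p * qk q"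
definition "norm (q :: quat) = sqrt (inner q q)"
definition sgn_quat_def: "sgn (q :: quat) = q /\<^sub>R norm q"
definition dist_quat_def: "dist p q = norm (p - q :: quat)"

definition uniformity_quat_def [code del]:
  "(uniformity :: (quat \<times> quat) filter) = (INF e\<in>{0 <..}. principal {(x, y). dist x y < e})"

definition open_quat_def [code del]:
  "open (U :: quat set) \<longleftrightarrow> (\<forall>x\<in>U. eventually (\<lambda>(x', y). x' = x \<longrightarrow> y \<in> U) uniformity)"

instance
proof
  fix p q s :: quat and r :: real
  show "inner p q = inner q p"
    by (simp add: inner_quat_def mult.commute)
  show "inner (p + q) s = inner p s + inner q s"
    by (simp add: inner_quat_def algebra_simps)
  show "inner (r *\<^sub>R p) q = r * inner p q"
    by (simp add: inner_quat_def algebra_simps)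
  show "0 \<le> inner p p"
    by (simp add: inner_quat_def)
  show "inner p p = 0 \<longleftrightarrow> p = 0"
    by (simp add: inner_quat_def add_nonneg_eq_0_iff quat_eq_iff)
qed (rule norm_quat_def sgn_quat_def dist_quat_def open_quat_def uniformity_quat_def)+

end

instantiation quat :: division_ring
begin

definition "inverse (q :: quat) = Quat (qre q) (- qi q) (- qj q) (- qk q) /\<^sub>R inner q q"
definition "divide p q = p * inverse (q :: quat)"

instance
proof
  fix p q :: quat
  have "inverse q * q = 1 \<and> q * inverse q = 1" if "q \<noteq> 0"
  proof -
    have "inner q q \<noteq> 0"
      using that by simp
    then have "inverse (inner q q) * inner q q = 1"
      by simp
    then show ?thesis
      unfolding inverse_quat_def
      by (simp add: quat_eq_iff quat_sel_times inner_quat_def algebra_simps)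
  qed
  then show "q \<noteq> 0 \<Longrightarrow> inverse q * q = 1" and "q \<noteq> 0 \<Longrightarrow> q * inverse q = 1"
    by simp_all
  show "p div q = p * inverse q"
    by (rule divide_quat_def)
  show "inverse (0 :: quat) = 0"
    by (simp add: inverse_quat_def)
qed

end

instance quat :: real_normed_div_algebra
proof
  fix p q :: quat
  show "norm (p * q) = norm p * norm q"
    unfolding norm_quat_def inner_quat_def real_sqrt_mult [symmetric] quat_sel_times
    by (rule arg_cong [of _ _ sqrt]) (simp add: algebra_simps)
qed

instantiation quat :: euclidean_space
begin

definition "Basis = {Quat 1 0 0 0, Quat 0 1 0 0, Quat 0 0 1 0, Quat 0 0 0 1}"

instance
proof
  show "(Basis :: quat set) \<noteq> {}" and "finite (Basis :: quat set)"
    by (simp_all add: Basis_quat_def)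
  show "inner u v = (if u = v then 1 else 0)" if "u \<in> Basis" "v \<in> Basis" for u v :: quat
    using that unfolding Basis_quat_def by (elim insertE emptyE) (simp_all add: inner_quat_def)
  show "(\<forall>u\<in>Basis. inner x u = 0) \<longleftrightarrow> x = 0" for x :: quat
    by (simp add: Basis_quat_def inner_quat_def quat_eq_iff [of x])
qed

end

section \<open>Slice regular functions and the slice derivative\<close>

definition imag_units :: "quat set"
  where "imag_units = {q. q\<^sup>2 = - 1}"

definition slice_point :: "quat \<Rightarrow> real \<Rightarrow> real \<Rightarrow> quat"  \<comment> \<open>\<open>x + I y\<close>\<close>
  where "slice_point I x y = of_real x + I * of_real y"

text \<open>The partial derivatives of \<open>f\<^sub>I\<close> at \<open>x + I y\<close>.\<close>

definition slice_dx :: "(quat \<Rightarrow> quat) \<Rightarrow> quat \<Rightarrow> real \<Rightarrow> real \<Rightarrow> quat"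
  where "slice_dx f I x y = vector_derivative (\<lambda>t. f (slice_point I t y)) (at x)"

definition slice_dy :: "(quat \<Rightarrow> quat) \<Rightarrow> quat \<Rightarrow> real \<Rightarrow> real \<Rightarrow> quat"
  where "slice_dy f I x y = vector_derivative (\<lambda>t. f (slice_point I x t)) (at y)"

definition slice_regular :: "(quat \<Rightarrow> quat) \<Rightarrow> bool"
  where "slice_regular f \<longleftrightarrow> (\<forall>I\<in>imag_units.
    (\<forall>x y. (\<lambda>t. f (slice_point I t y)) differentiable at x \<and>
           (\<lambda>t. f (slice_point I x t)) differentiable at y) \<and>
    continuous_on UNIV (\<lambda>(x, y). slice_dx f I x y) \<and>
    continuous_on UNIV (\<lambda>(x, y). slice_dy f I x y) \<and>
    (\<forall>x y. (1/2) *\<^sub>R (slice_dx f I x y + I * slice_dy f I x y) = 0))"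

text \<open>
  The representation \<open>q = x + I y\<close> is not unique (for real \<open>q\<close> the unit \<open>I\<close> is arbitrary).
  For slice regular \<open>f\<close> the value prescribed below does not depend on it: see
  \<open>slice_deriv_eq\<close>.
\<close>

definition slice_deriv :: "(quat \<Rightarrow> quat) \<Rightarrow> quat \<Rightarrow> quat"
  where "slice_deriv f q = (THE d. \<forall>I\<in>imag_units. \<forall>x y. q = slice_point I x y \<longrightarrow>
    d = (1/2) *\<^sub>R (slice_dx f I x y - I * slice_dy f I x y))"

lemma qre_imag_unit:
  assumes "I \<in> imag_units" shows "qre I = 0"
proof (rule ccontr)
  assume *: "qre I \<noteq> 0"
  have I: "I * I = - 1"
    using assms by (simp add: imag_units_def power2_eq_square)
  have "qi I = 0" "qj I = 0" "qk I = 0"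
    using arg_cong [OF I, of qi] arg_cong [OF I, of qj] arg_cong [OF I, of qk] *
    by (simp_all add: quat_sel_times)
  then have "qre I * qre I = - 1"
    using arg_cong [OF I, of qre] by (simp add: quat_sel_times)
  then show False
    using zero_le_square [of "qre I"] by linarith
qed

lemma slice_deriv_eq:
  assumes f: "slice_regular f" and I: "I \<in> imag_units"
  shows "slice_deriv f (slice_point I x y) =
    (1/2) *\<^sub>R (slice_dx f I x y - I * slice_dy f I x y)"
proof -
  have dx: "(1/2) *\<^sub>R (slice_dx f J u v - J * slice_dy f J u v) = slice_dx f J u v"
    if "J \<in> imag_units" for J u v
  proof -
    have "slice_dx f J u v + J * slice_dy f J u v = 0"
      using f that unfolding slice_regular_def by auto
    then have "J * slice_dy f J u v = - slice_dx f J u v"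
      by (simp add: eq_neg_iff_add_eq_0 add.commute)
    then show ?thesis
      using scaleR_half_double [of "slice_dx f J u v"] by simp
  qed
  have same: "slice_dx f J u v = slice_dx f I x y"
    if J: "J \<in> imag_units" and eq: "slice_point I x y = slice_point J u v" for J u v
  proof -
    have "qre (slice_point I x y) = qre (slice_point J u v)"
      using eq by simp
    then have "x = u"
      using qre_imag_unit [OF I] qre_imag_unit [OF J]
      by (simp add: slice_point_def quat_sel_times)
    with eq have "I * of_real y = J * of_real v"
      by (simp add: slice_point_def)
    with \<open>x = u\<close> show ?thesis
      by (simp add: slice_dx_def slice_point_def)
  qed
  show ?thesis
    unfolding slice_deriv_def
  proof (rule the_equality)
    show "\<forall>J\<in>imag_units. \<forall>u v. slice_point I x y = slice_point J u v \<longrightarrow>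
      (1/2) *\<^sub>R (slice_dx f I x y - I * slice_dy f I x y) =
      (1/2) *\<^sub>R (slice_dx f J u v - J * slice_dy f J u v)"
      using dx same I by metis
  qed (use I in blast)
qed

section \<open>Square integrable functions and the Segal--Bargmann transform\<close>

text \<open>
  Elements of \<open>L\<^sup>2\<close> are given by representatives; the notions below only depend on the class
  modulo equality almost everywhere.
\<close>

definition L2 :: "(real \<Rightarrow> quat) set"
  where "L2 = {\<phi>. \<phi> \<in> borel_measurable lebesgue \<and> integrable lebesgue (\<lambda>x. (norm (\<phi> x))\<^sup>2)}"

definition position_op :: "(real \<Rightarrow> quat) \<Rightarrow> real \<Rightarrow> quat"
  where "position_op \<phi> = (\<lambda>x. of_real x * \<phi> x)"

definition position_dom :: "(real \<Rightarrow> quat) set"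
  where "position_dom = {\<phi> \<in> L2. position_op \<phi> \<in> L2}"

definition sb_kernel :: "quat \<Rightarrow> real \<Rightarrow> quat"
  where "sb_kernel q x = of_real (pi powr (- 3/4)) *
    exp (- ((1/2) *\<^sub>R (q\<^sup>2 + of_real (x\<^sup>2))) + of_real (sqrt 2) * q * of_real x)"

definition segal_bargmann :: "(real \<Rightarrow> quat) \<Rightarrow> quat \<Rightarrow> quat"
  where "segal_bargmann \<phi> q = (LINT x|lebesgue. sb_kernel q x * \<phi> x)"

end

theory Submission
  imports Defs "HOL-Probability.Distributions"
begin

text \<open>
  On a slice \<open>\<complex>\<^sub>I\<close> the kernel is the image of its complex counterpart under the isometric embedding
  \<open>\<complex> \<rightarrow> \<complex>\<^sub>I\<close>. Pulling out the factor \<open>exp (- z\<^sup>2 / 2)\<close> leaves the two-sided Laplace transform, at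
  \<open>sqrt 2 * z\<close>, of \<open>exp (- t\<^sup>2 / 2) \<phi>(t)\<close>, which has exponential moments of every order.
  Differentiation of this Laplace transform multiplies the function by \<open>t\<close>, and differentiation of
  the Gaussian factor contributes the term \<open>- z\<close>; the product rule gives both the Cauchy--Riemann
  equation and the formula for the slice derivative.
\<close>

section \<open>The embedding of the complex plane onto a slice\<close>

definition slice_embed :: "quat \<Rightarrow> complex \<Rightarrow> quat"
  where "slice_embed I z = slice_point I (Re z) (Im z)"

lemma imag_unit_square:
  assumes "I \<in> imag_units" shows "I * I = - 1"
  using assms by (simp add: imag_units_def power2_eq_square)

lemma norm_imag_unit:
  assumes "I \<in> imag_units" shows "norm I = 1"
proof -
  have "norm I * norm I = 1"
    using arg_cong [OF imag_unit_square [OF assms], of norm] by (simp add: norm_mult)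
  then show ?thesis
    by (metis abs_norm_cancel abs_square_eq_1 power2_eq_square)
qed

text \<open>With a real scalar in place of a quaternion product, the real linearity of the embedding
  becomes visible.\<close>

lemma slice_embed_altdef: "slice_embed I z = of_real (Re z) + Im z *\<^sub>R I"
  by (simp add: slice_embed_def slice_point_def quat_eq_iff quat_sel_times)

lemma slice_embed_Complex: "slice_embed I (Complex x y) = slice_point I x y"
  by (simp add: slice_embed_def)

lemma slice_embed_of_real [simp]: "slice_embed I (of_real r) = of_real r"
  by (simp add: slice_embed_altdef)

lemma slice_embed_1 [simp]: "slice_embed I 1 = 1"
  by (simp add: slice_embed_altdef)

lemma slice_embed_mult:
  assumes "I \<in> imag_units"
  shows "slice_embed I (z * w) = slice_embed I z * slice_embed I w"
  using imag_unit_square [OF assms]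
  by (simp add: slice_embed_altdef of_real_def algebra_simps)

text \<open>\<open>I\<close> has norm one and vanishing real part, so \<open>1\<close> and
  \<open>I\<close> are orthonormal and Pythagoras applies.\<close>

lemma norm_slice_embed:
  assumes "I \<in> imag_units" shows "norm (slice_embed I z) = norm z"
proof -
  have "inner I I = 1"
    using norm_imag_unit [OF assms] by (simp add: norm_eq_1)
  moreover have "qre I = 0"
    by (rule qre_imag_unit [OF assms])
  ultimately have "inner (slice_embed I z) (slice_embed I z) = (Re z)\<^sup>2 + (Im z)\<^sup>2"
    by (simp add: slice_embed_altdef inner_add_left inner_add_right inner_commute
        power2_eq_square) (simp add: inner_quat_def)
  then show ?thesis
    by (simp add: norm_quat_def cmod_def)
qed

lemma bounded_linear_slice_embed: "bounded_linear (slice_embed I)"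
  unfolding slice_embed_altdef [abs_def] of_real_def
  by (intro bounded_linear_intros bounded_linear_Re bounded_linear_Im)

lemma slice_embed_add: "slice_embed I (z + w) = slice_embed I z + slice_embed I w"
  and slice_embed_diff: "slice_embed I (z - w) = slice_embed I z - slice_embed I w"
  and slice_embed_minus: "slice_embed I (- z) = - slice_embed I z"
  and slice_embed_scaleR: "slice_embed I (r *\<^sub>R z) = r *\<^sub>R slice_embed I z"
  by (simp_all add: slice_embed_altdef of_real_def algebra_simps)

lemma slice_embed_power:
  assumes "I \<in> imag_units" shows "slice_embed I (z ^ n) = slice_embed I z ^ n"
  by (induction n) (simp_all add: slice_embed_mult [OF assms])

text \<open>The embedding is bounded linear and respects powers, so it carries the exponential
  series over term by term.\<close>

lemma exp_slice_embed:
  assumes "I \<in> imag_units" shows "exp (slice_embed I z) = slice_embed I (exp z)"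
proof -
  have "(\<lambda>n. slice_embed I (z ^ n /\<^sub>R fact n)) sums slice_embed I (exp z)"
    by (rule bounded_linear.sums [OF bounded_linear_slice_embed exp_converges])
  then have "(\<lambda>n. slice_embed I z ^ n /\<^sub>R fact n) sums slice_embed I (exp z)"
    by (simp add: slice_embed_scaleR slice_embed_power [OF assms])
  with exp_converges show ?thesis
    by (rule sums_unique2)
qed

section \<open>Exponential moments and the two-sided Laplace transform\<close>

definition exp_moments :: "(real \<Rightarrow> quat) \<Rightarrow> bool"
  where "exp_moments \<psi> \<longleftrightarrow> \<psi> \<in> borel_measurable lebesgue \<and>
    (\<forall>a. integrable lebesgue (\<lambda>t. exp (a * \<bar>t\<bar>) * norm (\<psi> t)))"

text \<open>The exponential stands to the left of \<open>\<psi>\<close>, as in the kernel: the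
  values of \<open>\<psi>\<close> need not commute with the slice.\<close>

definition slice_laplace :: "quat \<Rightarrow> (real \<Rightarrow> quat) \<Rightarrow> complex \<Rightarrow> quat"
  where "slice_laplace I \<psi> z = (LINT t|lebesgue. slice_embed I (exp (z * of_real t)) * \<psi> t)"

lemma continuous_imp_borel_measurable_lebesgue:
  fixes f :: "'a::euclidean_space \<Rightarrow> 'b::topological_space"
  assumes "continuous_on UNIV f" shows "f \<in> borel_measurable lebesgue"
  using borel_measurable_continuous_onI [OF assms] by (intro measurable_completion) simp

lemma borel_measurable_slice_laplace_integrand:
  assumes "\<psi> \<in> borel_measurable lebesgue"
  shows "(\<lambda>t. slice_embed I (exp (z * of_real t)) * \<psi> t) \<in> borel_measurable lebesgue"
proof -
  have "continuous_on UNIV (\<lambda>t. slice_embed I (exp (z * of_real t)))"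
    by (intro bounded_linear.continuous_on [OF bounded_linear_slice_embed] continuous_intros)
  then have "(\<lambda>t. slice_embed I (exp (z * of_real t))) \<in> borel_measurable lebesgue"
    by (rule continuous_imp_borel_measurable_lebesgue)
  with assms show ?thesis
    by (rule borel_measurable_times [rotated])
qed

lemma norm_exp_mult_of_real_le: "norm (exp (z * of_real t)) \<le> exp (norm z * \<bar>t\<bar>)" for z :: complex
  using norm_exp [of "z * of_real t"] by (simp add: norm_mult)

lemma integrable_slice_laplace:
  assumes I: "I \<in> imag_units" and \<psi>: "exp_moments \<psi>"
  shows "integrable lebesgue (\<lambda>t. slice_embed I (exp (z * of_real t)) * \<psi> t)"
proof (rule Bochner_Integration.integrable_bound)
  show "integrable lebesgue (\<lambda>t. exp (norm z * \<bar>t\<bar>) * norm (\<psi> t))"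
    using \<psi> by (simp add: exp_moments_def)
  show "(\<lambda>t. slice_embed I (exp (z * of_real t)) * \<psi> t) \<in> borel_measurable lebesgue"
    using \<psi> by (simp add: exp_moments_def borel_measurable_slice_laplace_integrand)
  show "AE t in lebesgue. norm (slice_embed I (exp (z * of_real t)) * \<psi> t)
      \<le> norm (exp (norm z * \<bar>t\<bar>) * norm (\<psi> t))"
    using norm_exp_mult_of_real_le [of z]
    by (intro AE_I2) (simp add: norm_mult norm_slice_embed [OF I] mult_right_mono)
qed

lemma abs_le_exp_abs: "\<bar>t\<bar> \<le> exp \<bar>t\<bar>" for t :: real
  using exp_ge_add_one_self [of "\<bar>t\<bar>"] by linarith

text \<open>Since \<open>\<bar>t\<bar> \<le> exp \<bar>t\<bar>\<close>, the extra factor only raises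
  the exponent from \<open>a\<close> to \<open>a + 1\<close>. Such shifts are the reason why
  \<open>exp_moments\<close> demands every exponent.\<close>

lemma exp_moments_position_op:
  assumes "exp_moments \<psi>" shows "exp_moments (position_op \<psi>)"
  unfolding exp_moments_def
proof (intro conjI allI)
  have [measurable]: "\<psi> \<in> borel_measurable lebesgue"
    using assms by (simp add: exp_moments_def)
  have "(\<lambda>t. of_real t :: quat) \<in> borel_measurable lebesgue"
    by (intro continuous_imp_borel_measurable_lebesgue continuous_intros)
  then show [measurable]: "position_op \<psi> \<in> borel_measurable lebesgue"
    unfolding position_op_def by (intro borel_measurable_times) simp_all
  fix a :: real
  show "integrable lebesgue (\<lambda>t. exp (a * \<bar>t\<bar>) * norm (position_op \<psi> t))"
  proof (rule Bochner_Integration.integrable_bound)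
    show "integrable lebesgue (\<lambda>t. exp ((a + 1) * \<bar>t\<bar>) * norm (\<psi> t))"
      using assms by (simp add: exp_moments_def)
    have "(\<lambda>t::real. exp (a * \<bar>t\<bar>)) \<in> borel_measurable lebesgue"
      by (intro continuous_imp_borel_measurable_lebesgue continuous_intros)
    then show "(\<lambda>t. exp (a * \<bar>t\<bar>) * norm (position_op \<psi> t)) \<in> borel_measurable lebesgue"
      by (intro borel_measurable_times) simp_all
    show "AE t in lebesgue. norm (exp (a * \<bar>t\<bar>) * norm (position_op \<psi> t))
        \<le> norm (exp ((a + 1) * \<bar>t\<bar>) * norm (\<psi> t))"
    proof (rule AE_I2)
      fix t :: real
      have "exp (a * \<bar>t\<bar>) * (\<bar>t\<bar> * norm (\<psi> t)) \<le> exp (a * \<bar>t\<bar>) * (exp \<bar>t\<bar> * norm (\<psi> t))"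
        using abs_le_exp_abs by (intro mult_left_mono mult_right_mono) auto
      then show "norm (exp (a * \<bar>t\<bar>) * norm (position_op \<psi> t))
          \<le> norm (exp ((a + 1) * \<bar>t\<bar>) * norm (\<psi> t))"
        by (simp add: position_op_def norm_mult algebra_simps exp_add)
    qed
  qed
qed

text \<open>After factoring out \<open>exp (z * of_real t)\<close>, this is the first-order Taylor
  remainder of \<open>exp (w * of_real t)\<close>. Of the added exponent 3, one unit bounds
  \<open>exp (norm (w * of_real t))\<close> and two bound \<open>t\<^sup>2\<close>. The result is
  quadratic in \<open>norm w\<close>, with a weight in \<open>t\<close> that is free of
  \<open>w\<close>.\<close>

lemma exp_remainder_bound:
  fixes z w :: complex and t :: real
  assumes "norm w \<le> 1"
  shows "norm (exp ((z + w) * of_real t) - exp (z * of_real t) - w * of_real t * exp (z * of_real t))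
    \<le> (norm w)\<^sup>2 * exp ((norm z + 3) * \<bar>t\<bar>)"
proof -
  have "exp ((z + w) * of_real t) - exp (z * of_real t) - w * of_real t * exp (z * of_real t)
      = exp (z * of_real t) * (exp (w * of_real t) - (\<Sum>i\<le>1. (w * of_real t) ^ i / fact i))"
    by (simp add: algebra_simps exp_add)
  moreover have "norm (exp (w * of_real t) - (\<Sum>i\<le>1. (w * of_real t) ^ i / fact i))
      \<le> exp (norm (w * of_real t)) * norm (w * of_real t) ^ Suc 1 / fact 1"
    by (rule Taylor_exp_field)
  moreover have "\<dots> \<le> exp \<bar>t\<bar> * ((norm w)\<^sup>2 * (exp \<bar>t\<bar> * exp \<bar>t\<bar>))"
  proof -
    have "exp (norm (w * of_real t)) \<le> exp \<bar>t\<bar>"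
      using assms by (simp add: norm_mult mult_left_le_one_le)
    moreover have "\<bar>t\<bar> * \<bar>t\<bar> \<le> exp \<bar>t\<bar> * exp \<bar>t\<bar>"
      using mult_mono [OF abs_le_exp_abs [of t] abs_le_exp_abs [of t]] by simp
    ultimately have "exp (norm (w * of_real t)) * ((norm w)\<^sup>2 * (\<bar>t\<bar> * \<bar>t\<bar>))
        \<le> exp \<bar>t\<bar> * ((norm w)\<^sup>2 * (exp \<bar>t\<bar> * exp \<bar>t\<bar>))"
      by (intro mult_mono [of _ _ "(norm w)\<^sup>2 * _"] mult_left_mono) auto
    then show ?thesis
      by (simp add: norm_mult power2_eq_square mult_ac del: abs_mult_self_eq)
  qed
  ultimately have "norm (exp ((z + w) * of_real t) - exp (z * of_real t)
        - w * of_real t * exp (z * of_real t))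
      \<le> exp (norm z * \<bar>t\<bar>) * (exp \<bar>t\<bar> * ((norm w)\<^sup>2 * (exp \<bar>t\<bar> * exp \<bar>t\<bar>)))"
    using norm_exp_mult_of_real_le [of z t] by (simp add: norm_mult mult_mono)
  also have "\<dots> = (norm w)\<^sup>2 * exp ((norm z + 3) * \<bar>t\<bar>)"
    by (simp add: algebra_simps flip: exp_add)
  finally show ?thesis .
qed

text \<open>Integrating the remainder bound against \<open>norm (\<psi> t)\<close> gives an error
  quadratic in the increment, which justifies differentiation under the integral directly. The
  increment acts by left multiplication with \<open>slice_embed I w\<close>; this shape of the real
  derivative encodes the Cauchy-Riemann equation.\<close>

lemma slice_laplace_has_derivative:
  assumes I: "I \<in> imag_units" and \<psi>: "exp_moments \<psi>"
  shows "(slice_laplace I \<psi> has_derivative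
    (\<lambda>w. slice_embed I w * slice_laplace I (position_op \<psi>) z)) (at z)"
\<comment> \<open>Radius 1 matches the range \<open>norm w \<le> 1\<close> of the remainder
  bound.\<close>
proof (rule has_derivativeI_sandwich [where e = 1])
  let ?h = "slice_embed I" and ?D = "slice_laplace I (position_op \<psi>) z"
  let ?M = "\<lambda>t. exp ((norm z + 3) * \<bar>t\<bar>) * norm (\<psi> t)"
  show "bounded_linear (\<lambda>w. ?h w * ?D)"
    by (intro bounded_linear_mult_const bounded_linear_slice_embed)
  have M: "integrable lebesgue ?M"
    using \<psi> by (simp add: exp_moments_def)
  show "((\<lambda>y. norm (y - z) * integral\<^sup>L lebesgue ?M) \<longlongrightarrow> 0) (at z)"
    by (auto intro!: tendsto_eq_intros)
  fix y assume yz: "y \<noteq> z" "dist y z < 1"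
  define w where "w = y - z"
  have y: "y = z + w" and w: "norm w \<le> 1" "w \<noteq> 0"
    using yz by (simp_all add: w_def dist_norm)
  let ?R = "\<lambda>t. exp (y * of_real t) - exp (z * of_real t) - w * of_real t * exp (z * of_real t)"
  have "slice_laplace I \<psi> y - slice_laplace I \<psi> z - ?h w * ?D = (LINT t|lebesgue.
      ?h (exp (y * of_real t)) * \<psi> t - ?h (exp (z * of_real t)) * \<psi> t
      - ?h w * (?h (exp (z * of_real t)) * position_op \<psi> t))"
    unfolding slice_laplace_def
    using integrable_slice_laplace [OF I \<psi>]
      integrable_slice_laplace [OF I exp_moments_position_op [OF \<psi>]] by simp
  also have "\<dots> = (LINT t|lebesgue. ?h (?R t) * \<psi> t)"
  proof (rule Bochner_Integration.integral_cong [OF refl])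
    fix t :: real
    \<comment> \<open>Factors inside the slice commute and the embedding fixes the real number
      \<open>t\<close>, so \<open>t\<close> can move next to \<open>\<psi> t\<close> and form
      \<open>position_op \<psi> t\<close>.\<close>
    have "?h (w * of_real t * exp (z * of_real t)) = ?h w * (?h (exp (z * of_real t)) * of_real t)"
      by (simp add: slice_embed_mult [OF I] mult.assoc) 
         (metis slice_embed_of_real slice_embed_mult [OF I] mult.commute)
    then show "?h (exp (y * of_real t)) * \<psi> t - ?h (exp (z * of_real t)) * \<psi> t
      - ?h w * (?h (exp (z * of_real t)) * position_op \<psi> t) = ?h (?R t) * \<psi> t"
      by (simp add: slice_embed_diff position_op_def left_diff_distrib mult.assoc)
  qed
  finally have eq: "slice_laplace I \<psi> y - slice_laplace I \<psi> z - ?h w * ?D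
    = (LINT t|lebesgue. ?h (?R t) * \<psi> t)" .
  have "norm (LINT t|lebesgue. ?h (?R t) * \<psi> t) \<le> (LINT t|lebesgue. norm (?h (?R t) * \<psi> t))"
    by (rule integral_norm_bound)
  also have "\<dots> \<le> (LINT t|lebesgue. (norm w)\<^sup>2 * ?M t)"
  proof (rule integral_mono')
    show "integrable lebesgue (\<lambda>t. (norm w)\<^sup>2 * ?M t)"
      using M by simp
    show "norm (?h (?R t) * \<psi> t) \<le> (norm w)\<^sup>2 * ?M t" for t
    proof -
      have "norm (?R t) * norm (\<psi> t) \<le> (norm w)\<^sup>2 * exp ((norm z + 3) * \<bar>t\<bar>) * norm (\<psi> t)"
        unfolding y by (intro mult_right_mono exp_remainder_bound w) simp
      then show ?thesis
        by (simp add: norm_mult norm_slice_embed [OF I] mult.assoc)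
    qed
  qed simp
  \<comment> \<open>One factor \<open>norm w\<close> is split off to cancel the denominator of the
    difference quotient.\<close>
  finally have "norm (LINT t|lebesgue. ?h (?R t) * \<psi> t) \<le> norm w * (norm w * integral\<^sup>L lebesgue ?M)"
    by (simp add: power2_eq_square mult.assoc)
  then show "norm (slice_laplace I \<psi> y - slice_laplace I \<psi> z - ?h (y - z) * ?D) / norm (y - z)
      \<le> norm (y - z) * integral\<^sup>L lebesgue ?M"
    using w eq by (simp add: w_def [symmetric] divide_le_eq mult.commute)
qed simp

section \<open>The Gaussian weight and the factorisation of the kernel\<close>

definition gauss_weight :: "(real \<Rightarrow> quat) \<Rightarrow> real \<Rightarrow> quat"
  where "gauss_weight \<phi> t = exp (- t\<^sup>2 / 2) *\<^sub>R \<phi> t"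

text \<open>For \<open>u = exp (a * \<bar>t\<bar> - t\<^sup>2 / 2)\<close> the integrand
  \<open>u * norm (\<phi> t)\<close> is at most
  \<open>u\<^sup>2 + (norm (\<phi> t))\<^sup>2\<close>. The first term is dominated by a Gaussian,
  the second is integrable by membership in \<open>L2\<close>.\<close>

lemma exp_moments_gauss_weight:
  assumes "\<phi> \<in> L2" shows "exp_moments (gauss_weight \<phi>)"
  unfolding exp_moments_def
proof (intro conjI allI)
  have [measurable]: "\<phi> \<in> borel_measurable lebesgue"
    using assms by (simp add: L2_def)
  have "(\<lambda>t::real. exp (- t\<^sup>2 / 2)) \<in> borel_measurable lebesgue"
    by (intro continuous_imp_borel_measurable_lebesgue continuous_intros) auto
  then show [measurable]: "gauss_weight \<phi> \<in> borel_measurable lebesgue"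
    unfolding gauss_weight_def [abs_def] by (intro borel_measurable_scaleR) simp_all
  fix a :: real
  show "integrable lebesgue (\<lambda>t. exp (a * \<bar>t\<bar>) * norm (gauss_weight \<phi> t))"
  proof (rule Bochner_Integration.integrable_bound)
    \<comment> \<open>The standard normal density supplies the integrability of
      \<open>exp (- t\<^sup>2 / 2)\<close>; the factor \<open>sqrt (2 * pi)\<close> below undoes its
      normalisation.\<close>
    have "integrable lebesgue (normal_density 0 1)"
      by (subst integrable_completion) auto
    moreover have "integrable lebesgue (\<lambda>t. (norm (\<phi> t))\<^sup>2)"
      using assms by (simp add: L2_def)
    ultimately show "integrable lebesgue (\<lambda>t. exp (2 * a\<^sup>2) * (sqrt (2 * pi) * normal_density 0 1 t)
        + (norm (\<phi> t))\<^sup>2)"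
      by simp
    have "(\<lambda>t::real. exp (a * \<bar>t\<bar>)) \<in> borel_measurable lebesgue"
      by (intro continuous_imp_borel_measurable_lebesgue continuous_intros)
    then show "(\<lambda>t. exp (a * \<bar>t\<bar>) * norm (gauss_weight \<phi> t)) \<in> borel_measurable lebesgue"
      by (intro borel_measurable_times) simp_all
    show "AE t in lebesgue. norm (exp (a * \<bar>t\<bar>) * norm (gauss_weight \<phi> t))
        \<le> norm (exp (2 * a\<^sup>2) * (sqrt (2 * pi) * normal_density 0 1 t) + (norm (\<phi> t))\<^sup>2)"
    proof (rule AE_I2)
      fix t :: real
      define u where "u = exp (a * \<bar>t\<bar> - t\<^sup>2 / 2)"
      \<comment> \<open>Completing the square: \<open>2 * a * \<bar>t\<bar> - t\<^sup>2\<close> is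
        \<open>2 * a\<^sup>2 - t\<^sup>2 / 2\<close> minus half of this square.\<close>
      have "0 \<le> (2 * a - \<bar>t\<bar>)\<^sup>2"
        by simp
      then have "2 * (a * \<bar>t\<bar> - t\<^sup>2 / 2) \<le> 2 * a\<^sup>2 + - t\<^sup>2 / 2"
        by (simp add: power2_eq_square algebra_simps)
      then have "u\<^sup>2 \<le> exp (2 * a\<^sup>2) * exp (- t\<^sup>2 / 2)"
        unfolding u_def by (simp flip: exp_add exp_double)
      moreover have "2 * (u * norm (\<phi> t)) \<le> u\<^sup>2 + (norm (\<phi> t))\<^sup>2"
        using sum_squares_bound [of u "norm (\<phi> t)"] by (simp add: mult.assoc)
      moreover have u: "0 \<le> u * norm (\<phi> t)"
        by (simp add: u_def)
      ultimately have "u * norm (\<phi> t) \<le> exp (2 * a\<^sup>2) * exp (- t\<^sup>2 / 2) + (norm (\<phi> t))\<^sup>2"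
        by linarith
      moreover have "sqrt (2 * pi) * normal_density 0 1 t = exp (- t\<^sup>2 / 2)"
        by (simp add: normal_density_def)
      moreover have "exp (a * \<bar>t\<bar>) * norm (gauss_weight \<phi> t) = u * norm (\<phi> t)"
        by (simp add: gauss_weight_def u_def flip: exp_add mult.assoc)
      ultimately show "norm (exp (a * \<bar>t\<bar>) * norm (gauss_weight \<phi> t))
        \<le> norm (exp (2 * a\<^sup>2) * (sqrt (2 * pi) * normal_density 0 1 t) + (norm (\<phi> t))\<^sup>2)"
        by (simp add: abs_of_nonneg [OF u])
    qed
  qed
qed

text \<open>Real factors commute. Hence differentiating the Laplace transform belonging to
  \<open>\<phi>\<close> yields the one belonging to \<open>position_op \<phi>\<close>.\<close>

lemma position_op_gauss_weight: "position_op (gauss_weight \<phi>) = gauss_weight (position_op \<phi>)"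
  by (simp add: position_op_def gauss_weight_def fun_eq_iff)

text \<open>The factor of the kernel that is constant in the integration variable; its logarithmic
  derivative \<open>- z\<close> is the source of the term \<open>q\<close> in the operator.\<close>

definition sb_factor :: "complex \<Rightarrow> complex"
  where "sb_factor z = of_real (pi powr (- 3/4)) * exp (- (z\<^sup>2 / 2))"

text \<open>A quaternionic exponential of a sum does not split in general. On a slice the whole
  exponent is the image of a complex number, so the splitting is done in the complex plane and then
  transported.\<close>

lemma sb_kernel_slice_embed:
  assumes I: "I \<in> imag_units"
  shows "sb_kernel (slice_embed I z) t * \<phi> t = slice_embed I (sb_factor z) *
    (slice_embed I (exp (of_real (sqrt 2) * z * of_real t)) * gauss_weight \<phi> t)"
proof -
  let ?h = "slice_embed I"
  have "- ((1/2) *\<^sub>R ((?h z)\<^sup>2 + of_real (t\<^sup>2))) + of_real (sqrt 2) * ?h z * of_real t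
      = ?h (- ((1/2) *\<^sub>R (z\<^sup>2 + of_real (t\<^sup>2))) + of_real (sqrt 2) * z * of_real t)"
    by (simp only: slice_embed_add slice_embed_minus slice_embed_scaleR slice_embed_of_real
        slice_embed_mult [OF I] slice_embed_power [OF I])
  moreover have "exp (- ((1/2) *\<^sub>R (z\<^sup>2 + of_real (t\<^sup>2))) + of_real (sqrt 2) * z * of_real t)
      = exp (- (z\<^sup>2 / 2)) * (exp (of_real (sqrt 2) * z * of_real t) * of_real (exp (- t\<^sup>2 / 2)))"
    unfolding exp_of_real [symmetric] exp_add [symmetric]
    by (rule arg_cong [of _ _ exp]) (simp add: scaleR_conv_of_real field_simps)
  ultimately have "sb_kernel (?h z) t = of_real (pi powr (- 3/4)) * (?h (exp (- (z\<^sup>2 / 2))) *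
      (?h (exp (of_real (sqrt 2) * z * of_real t)) * of_real (exp (- t\<^sup>2 / 2))))"
    unfolding sb_kernel_def
    by (simp only: exp_slice_embed [OF I] slice_embed_mult [OF I] slice_embed_of_real)
  then show ?thesis
    by (simp add: sb_factor_def slice_embed_mult [OF I] gauss_weight_def mult.assoc
        scaleR_conv_of_real)
qed

lemma segal_bargmann_slice_embed:
  assumes I: "I \<in> imag_units" and \<phi>: "\<phi> \<in> L2"
  shows "segal_bargmann \<phi> (slice_embed I z) =
    slice_embed I (sb_factor z) * slice_laplace I (gauss_weight \<phi>) (of_real (sqrt 2) * z)"
  unfolding segal_bargmann_def slice_laplace_def sb_kernel_slice_embed [OF I]
  using integrable_slice_laplace [OF I exp_moments_gauss_weight [OF \<phi>]] by simp

text \<open>In the product rule, \<open>sb_factor\<close> contributes the factor \<open>- z\<close>,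
  and the chain rule through \<open>of_real (sqrt 2) * z\<close> contributes \<open>sqrt 2\<close>
  together with the transform of \<open>position_op \<phi>\<close>.\<close>

lemma segal_bargmann_slice_has_derivative:
  assumes I: "I \<in> imag_units" and \<phi>: "\<phi> \<in> L2" and x\<phi>: "position_op \<phi> \<in> L2"
  shows "((\<lambda>z. segal_bargmann \<phi> (slice_embed I z)) has_derivative
    (\<lambda>w. slice_embed I w * (of_real (sqrt 2) * segal_bargmann (position_op \<phi>) (slice_embed I z)
      - slice_embed I z * segal_bargmann \<phi> (slice_embed I z)))) (at z)"
proof -
  let ?h = "slice_embed I" and ?L = "slice_laplace I (gauss_weight \<phi>)"
  let ?L' = "slice_laplace I (gauss_weight (position_op \<phi>))"
  have "(sb_factor has_field_derivative - z * sb_factor z) (at z)"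
    unfolding sb_factor_def [abs_def] by (auto intro!: derivative_eq_intros)
  then have "(sb_factor has_derivative (\<lambda>w. - z * sb_factor z * w)) (at z)"
    by (rule has_field_derivative_imp_has_derivative)
  then have 1: "((\<lambda>z. ?h (sb_factor z)) has_derivative (\<lambda>w. ?h (- z * sb_factor z * w))) (at z)"
    by (rule bounded_linear.has_derivative [OF bounded_linear_slice_embed])
  have "((\<lambda>z. of_real (sqrt 2) * z) has_derivative (\<lambda>w. of_real (sqrt 2) * w)) (at z)"
    for z :: complex
    by (auto intro!: derivative_eq_intros)
  from has_derivative_compose [OF this slice_laplace_has_derivative [OF I
      exp_moments_gauss_weight [OF \<phi>], unfolded position_op_gauss_weight]]
  have 2: "((\<lambda>z. ?L (of_real (sqrt 2) * z)) has_derivative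
      (\<lambda>w. ?h (of_real (sqrt 2) * w) * ?L' (of_real (sqrt 2) * z))) (at z)" .
  \<comment> \<open>Only slice-valued factors are permuted, to bring the increment to the far left;
    the Laplace transforms stay on the right.\<close>
  have com: "?h (sb_factor z) * ?h (of_real (sqrt 2) * w) = ?h w * (of_real (sqrt 2) * ?h (sb_factor z))"
    "?h (- (z * sb_factor z * w)) = - (?h w * (?h z * ?h (sb_factor z)))" for w
    unfolding slice_embed_of_real [of I, symmetric] slice_embed_mult [OF I, symmetric]
      slice_embed_minus [symmetric]
    by (simp_all add: mult_ac)
  show ?thesis
    unfolding segal_bargmann_slice_embed [OF I \<phi>] segal_bargmann_slice_embed [OF I x\<phi>]
    by (rule has_derivative_eq_rhs [OF has_derivative_mult [OF 1 2]])
      (simp add: fun_eq_iff com right_diff_distrib flip: mult.assoc)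
qed

section \<open>Partial derivatives along a slice and their continuity\<close>

lemma has_vector_derivative_slice:
  assumes "(g has_derivative (\<lambda>w. slice_embed I w * d)) (at (Complex x y))"
  shows "((\<lambda>t. g (Complex t y)) has_vector_derivative d) (at x)"
    and "((\<lambda>t. g (Complex x t)) has_vector_derivative I * d) (at y)"
proof -
  have x: "((\<lambda>t. Complex t y) has_derivative (\<lambda>s. of_real s)) (at x)"
    unfolding Complex_eq by (auto intro!: derivative_eq_intros)
  have y: "((\<lambda>t. Complex x t) has_derivative (\<lambda>s. \<i> * of_real s)) (at y)"
    unfolding Complex_eq by (auto intro!: derivative_eq_intros)
  have "slice_embed I (of_real s) * d = s *\<^sub>R d" for s
    by (simp add: scaleR_conv_of_real)
  with has_derivative_compose [OF x assms]
  show "((\<lambda>t. g (Complex t y)) has_vector_derivative d) (at x)"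
    by (simp add: has_vector_derivative_def scaleR_conv_of_real)
  \<comment> \<open>The vertical direction \<open>\<i>\<close> is embedded as \<open>I\<close>, so
    this partial derivative is \<open>I\<close> times the horizontal one: the Cauchy-Riemann
    equation.\<close>
  have "slice_embed I (\<i> * of_real s) * d = s *\<^sub>R (I * d)" for s
    by (simp add: slice_embed_altdef)
  with has_derivative_compose [OF y assms]
  show "((\<lambda>t. g (Complex x t)) has_vector_derivative I * d) (at y)"
    by (simp add: has_vector_derivative_def)
qed

lemma continuous_on_slice_laplace:
  assumes "I \<in> imag_units" "exp_moments \<psi>"
  shows "continuous_on S (slice_laplace I \<psi>)"
  using slice_laplace_has_derivative [OF assms] has_derivative_continuous
    continuous_at_imp_continuous_on by metis

text \<open>Stated on all of \<open>L2\<close> in order to cover both \<open>\<phi>\<close> and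
  \<open>position_op \<phi>\<close>, whose transforms enter the partial derivatives.\<close>

lemma continuous_on_segal_bargmann_slice:
  assumes I: "I \<in> imag_units" and \<phi>: "\<phi> \<in> L2"
  shows "continuous_on UNIV (\<lambda>z. segal_bargmann \<phi> (slice_embed I z))"
proof -
  have "continuous_on UNIV (\<lambda>z. slice_laplace I (gauss_weight \<phi>) (of_real (sqrt 2) * z))"
    by (rule continuous_on_compose2 [OF continuous_on_slice_laplace [OF I
      exp_moments_gauss_weight [OF \<phi>], of UNIV]]) (auto intro!: continuous_intros)
  then show ?thesis
    unfolding segal_bargmann_slice_embed [OF I \<phi>] sb_factor_def
    by (intro continuous_intros bounded_linear.continuous_on [OF bounded_linear_slice_embed]) auto
qed

text \<open>The imaginary part \<open>v\<close> of \<open>q\<close> squares to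
  \<open>- of_real ((norm v)\<^sup>2)\<close>, so if nonzero it becomes an imaginary unit after
  normalisation.\<close>

lemma slice_exists: "\<exists>I\<in>imag_units. \<exists>x y. q = slice_point I x y"
proof (cases "Quat 0 (qi q) (qj q) (qk q) = 0")
  case True
  \<comment> \<open>For real \<open>q\<close> every unit serves; the first one of the standard basis
    is taken.\<close>
  have "Quat 0 1 0 0 \<in> imag_units"
    by (simp add: imag_units_def power2_eq_square quat_eq_iff quat_sel_times)
  moreover have "q = slice_point (Quat 0 1 0 0) (qre q) 0"
    using True by (simp add: slice_point_def quat_eq_iff)
  ultimately show ?thesis by blast
next
  case False
  define v where "v = Quat 0 (qi q) (qj q) (qk q)"
  have v: "norm v \<noteq> 0" "v * v = - of_real ((norm v)\<^sup>2)"
    using False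
    by (simp_all add: v_def power2_norm_eq_inner quat_eq_iff quat_sel_times)
      (simp add: inner_quat_def)
  then have "(v /\<^sub>R norm v) * (v /\<^sub>R norm v) = - 1"
    by (simp add: of_real_def power2_eq_square field_simps)
  then have "v /\<^sub>R norm v \<in> imag_units"
    by (simp add: imag_units_def power2_eq_square)
  moreover have "q = slice_point (v /\<^sub>R norm v) (qre q) (norm v)"
    using v(1) unfolding slice_point_def quat_eq_iff
    by (simp add: quat_sel_times del: norm_eq_zero) (simp add: v_def)
  ultimately show ?thesis by blast
qed

theorem theorem3p6:
  fixes \<phi> :: "real \<Rightarrow> quat"
  assumes "\<phi> \<in> position_dom"
  shows "slice_regular (segal_bargmann \<phi>) \<and>
    (\<forall>q. slice_deriv (segal_bargmann \<phi>) q + q * segal_bargmann \<phi> q =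
      of_real (sqrt 2) * segal_bargmann (position_op \<phi>) q)"
proof -
  let ?B = "segal_bargmann \<phi>"
  \<comment> \<open>The candidate for the slice derivative: the asserted identity solved for
    \<open>slice_deriv\<close>.\<close>
  define D where "D q = of_real (sqrt 2) * segal_bargmann (position_op \<phi>) q - q * ?B q" for q
  have \<phi>: "\<phi> \<in> L2" and x\<phi>: "position_op \<phi> \<in> L2"
    using assms by (simp_all add: position_dom_def)
  have deriv: "((\<lambda>t. ?B (slice_point I t y)) has_vector_derivative D (slice_point I x y)) (at x)"
    "((\<lambda>t. ?B (slice_point I x t)) has_vector_derivative I * D (slice_point I x y)) (at y)"
    if "I \<in> imag_units" for I x y
    using has_vector_derivative_slice [OF
        segal_bargmann_slice_has_derivative [OF that \<phi> x\<phi>, folded D_def, of "Complex x y"]]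
    by (simp_all add: slice_embed_Complex)
  then have dx: "slice_dx ?B I x y = D (slice_point I x y)"
    and dy: "slice_dy ?B I x y = I * D (slice_point I x y)" if "I \<in> imag_units" for I x y
    using that by (simp_all add: slice_dx_def slice_dy_def vector_derivative_at)
  have cont: "continuous_on UNIV (\<lambda>(x, y). D (slice_point I x y))" if "I \<in> imag_units" for I
  proof -
    have "continuous_on UNIV (\<lambda>z. D (slice_embed I z))"
      unfolding D_def
      by (intro continuous_intros continuous_on_segal_bargmann_slice that \<phi> x\<phi>
          linear_continuous_on bounded_linear_slice_embed)
    moreover have "continuous_on UNIV (\<lambda>p. Complex (fst p) (snd p))"
      unfolding Complex_eq by (intro continuous_intros)
    ultimately have "continuous_on UNIV (\<lambda>p. D (slice_embed I (Complex (fst p) (snd p))))"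
      by (rule continuous_on_compose2) simp
    then show ?thesis
      by (simp add: slice_embed_Complex case_prod_unfold)
  qed
  \<comment> \<open>For the partial derivatives \<open>D\<close> and \<open>I * D\<close> this makes
    the Cauchy-Riemann sum vanish, while the difference in the slice derivative becomes
    \<open>D + D\<close>.\<close>
  have II: "I * (I * d) = - d" if "I \<in> imag_units" for I d
    using imag_unit_square [OF that] by (simp flip: mult.assoc)
  have "continuous_on UNIV (\<lambda>(x, y). I * D (slice_point I x y))" if "I \<in> imag_units" for I
    using continuous_on_mult_left [OF cont [OF that], of I] by (simp add: case_prod_unfold)
  then have reg: "slice_regular ?B"
    unfolding slice_regular_def
    using differentiableI_vector [OF deriv(1)] differentiableI_vector [OF deriv(2)] cont
    by (intro ballI conjI allI) (simp_all add: dx dy II case_prod_unfold)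
  moreover have "slice_deriv ?B q = D q" for q
  proof -
    \<comment> \<open>By \<open>slice_deriv_eq\<close>, any one slice through \<open>q\<close>
      determines the value.\<close>
    obtain I x y where I: "I \<in> imag_units" and q: "q = slice_point I x y"
      using slice_exists by blast
    have "slice_deriv ?B q = (1/2) *\<^sub>R (D q + D q)"
      unfolding q slice_deriv_eq [OF reg I] by (simp add: dx dy II I)
    then show ?thesis
      by simp
  qed
  ultimately show ?thesis
    by (simp add: D_def)
qed

end
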